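(* Let $$\mathcal{R} = \left\{(\beta,\alpha)\in\mathbb{R}^2:\ \beta>-1,\ -\beta-1<\alpha\le 0\right\}\cup\left\{(\beta,\alpha)\in\mathbb{R}^2:\ \beta>0,\ 0<\alpha\le\min\left(\beta,\tfrac12\right)\right\}.$$ Let $\mu>0$, $\lambda\ge 0$ and $(\beta,\alpha)\in\mathcal{R}$. Then $$\int_0^x \left(x^\mu-t^\mu\right)^\lambda t^\alpha J_\beta(t)\,dt>0\qquad\text{for all } x>0,$$ unless $\lambda=0$ and $\alpha=\beta=\frac12$. In this exceptional case, for all $x>0$, $$\int_0^x J_{\frac12}(t)\sqrt t\,dt=\frac{2\sqrt2}{\sqrt\pi}\,\sin^2\left(\frac x2\right)\ge 0.$$
   Context: $J_\beta$ denotes the Bessel function of the first kind of order $\beta>-1$, $J_\beta(t)=\sum_{k=0}^\infty \frac{(-1)^k}{k!\,\Gamma(k+\beta+1)}\left(\frac t2\right)^{2k+\beta}$ for $t>0$. All parameters are real. For $\lambda=0$ the factor $(x^\mu-t^\mu)^\lambda$ is $1$ for $0<t<x$. *)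

theory Defs
  imports "HOL-Analysis.Analysis"
begin

text \<open>
  Only used for \<open>\<beta> > -1\<close> and \<open>t > 0\<close>, where the Gamma function is evaluated at positive
  arguments and the series converges absolutely.
\<close>

definition bessel_J :: "real \<Rightarrow> real \<Rightarrow> real" where
  "bessel_J \<beta> t =
     (\<Sum>k. (-1) ^ k / (fact k * Gamma (real k + \<beta> + 1)) * (t / 2) powr (2 * real k + \<beta>))"

definition region_R :: "(real \<times> real) set" where
  "region_R =
     {(\<beta>, \<alpha>). \<beta> > -1 \<and> -\<beta> - 1 < \<alpha> \<and> \<alpha> \<le> 0} \<union>
     {(\<beta>, \<alpha>). \<beta> > 0 \<and> 0 < \<alpha> \<and> \<alpha> \<le> min \<beta> (1 / 2)}"

end

theory Submission imports Defs begin

text \<open>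
  Write \<open>F\<^bsub>\<alpha>\<^esub>(x)\<close> for the integral of \<open>t\<^sup>\<alpha> J\<^sub>\<beta>(t)\<close> over \<open>(0, x)\<close>; below it is \<open>bessel_moment \<alpha> \<beta> x\<close>.
  For \<open>l = 0\<close> the claim is \<open>F\<^bsub>\<alpha>\<^esub> > 0\<close>, and for \<open>l > 0\<close> it follows from \<open>F\<^bsub>\<alpha>\<^esub> \<ge> 0\<close>: integration by
  parts moves the derivative onto the weight and turns the weighted integral into the integral of \<open>l \<mu> t\<^bsup>\<mu>-1\<^esup> (x\<^sup>\<mu> - t\<^sup>\<mu>)\<^bsup>l-1\<^esup> F\<^bsub>\<alpha>\<^esub>(t)\<close>, a nonnegative
  function that is positive near \<open>0\<close> (\<open>weighted_bessel_integral_pos\<close>).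

  Lowering the exponent preserves positivity: the derivative of \<open>F\<^bsub>\<alpha>\<^esub>(x) - x\<^bsup>\<alpha>-\<gamma>\<^esup> F\<^bsub>\<gamma>\<^esub>(x)\<close> is
  \<open>(\<gamma> - \<alpha>) x\<^bsup>\<alpha>-\<gamma>-1\<^esup> F\<^bsub>\<gamma>\<^esub>(x)\<close>, so \<open>F\<^bsub>\<gamma>\<^esub> \<ge> 0\<close> implies \<open>F\<^bsub>\<alpha>\<^esub> > 0\<close> for \<open>\<alpha> < \<gamma>\<close>
  (\<open>bessel_moment_pos_if_larger_exponent\<close>). Hence only the
  upper edges \<open>\<alpha> = 0\<close> and \<open>\<alpha> = min \<beta> (1/2)\<close> of the two pieces of the region matter:

  \<^item> \<open>\<alpha> = 0\<close>, \<open>\<beta> > -1\<close> and \<open>\<alpha> = \<beta> < 1/2\<close>. Put \<open>a = (\<alpha> + \<beta> + 1) / 2\<close>. Up to a constant and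
    a power of \<open>x\<close>, \<open>F\<^bsub>\<alpha>\<^esub>\<close> is the hypergeometric function 1F2 with parameters \<open>a; a + 1, \<beta> + 1\<close> at \<open>- x\<^sup>2 / 4\<close>, while the
    square of \<open>J\<^bsub>a-1/2\<^esub>(x/2)\<close> is, in the same sense, the one with parameters \<open>a; 2 a, a + 1/2\<close>. In
    both cases one lower parameter is already right, and the other one, which is \<open>a + 1/2\<close> if
    \<open>\<alpha> = 0\<close> and \<open>2 a\<close> if \<open>\<alpha> = \<beta>\<close>, has to be raised to \<open>a + 1\<close>. A Beta integral of the square
    does this, so \<open>F\<^bsub>\<alpha>\<^esub>\<close> is an average of squares.

  \<^item> \<open>\<alpha> = 1/2\<close>, \<open>\<beta> > 1/2\<close>. The function \<open>u(t) = t\<^bsup>1/2\<^esup> J\<^sub>\<beta>(t)\<close> satisfies \<open>u'' + q u = 0\<close> with an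
    increasing \<open>q\<close>. With \<open>U' = u\<close>, \<open>U(0) = 0\<close>, the quantity \<open>W = U U'' - U'\<^sup>2 / 2 + q U\<^sup>2 / 2\<close> has
    the derivative \<open>q' U\<^sup>2 / 2\<close> and starts at \<open>0\<close>, so \<open>W > 0\<close>. At a zero of \<open>U\<close>, however,
    \<open>W = - U'\<^sup>2 / 2 \<le> 0\<close>. So \<open>U\<close> has no zero (\<open>bessel_moment_half_pos\<close>).

  \<^item> \<open>\<alpha> = \<beta> = 1/2\<close>. Here \<open>u\<close> is a multiple of the sine, which gives the explicit formula.
\<close>

section \<open>Positivity criteria and domination\<close>

lemma integral_pos_if_continuous_nonneg:
  fixes f :: "real \<Rightarrow> real"
  assumes int: "(f has_integral I) {a..b}"
    and cont: "continuous_on {a<..<b} f"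
    and nonneg: "\<And>t. t \<in> {a<..<b} \<Longrightarrow> f t \<ge> 0"
    and pos: "c \<in> {a<..<b}" "f c > 0"
  shows "I > 0"
proof -
  define d where "d = (c + b) / 2"
  have d: "c < d" "a < c" "d < b" using pos by (auto simp: d_def)
  have sub: "{c..d} \<subseteq> {a<..<b}" using d by auto
  have cont': "continuous_on {c..d} f" using cont sub by (rule continuous_on_subset)
  have "integral {c..d} f \<noteq> 0"
    using integral_eq_0_iff[OF cont' \<open>c < d\<close>] nonneg sub pos d by fastforce
  moreover have "integral {c..d} f \<ge> 0"
    by (rule integral_nonneg[OF integrable_continuous_real[OF cont']]) (use nonneg sub in auto)
  moreover have "integral {c..d} f \<le> integral {a<..<b} f"
    using int nonneg by (intro integral_subset_le sub integrable_continuous_real cont')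
      (auto simp: has_integral_Icc_iff_Ioo)
  moreover have "integral {a<..<b} f = I"
    using int by (simp add: has_integral_Icc_iff_Ioo integral_unique)
  ultimately show ?thesis by linarith
qed

text \<open>
  The functions to which this is applied behave like real powers at the origin and need not be
  differentiable there; hence the split between continuity at \<open>0\<close> and derivatives beyond it.
\<close>

lemma pos_if_deriv_nonneg:
  fixes f f' :: "real \<Rightarrow> real"
  assumes cont: "continuous_on {0..} f" and f0: "f 0 = 0"
    and der: "\<And>t. t > 0 \<Longrightarrow> (f has_real_derivative f' t) (at t)"
    and nonneg: "\<And>t. t > 0 \<Longrightarrow> f' t \<ge> 0"
    and near0: "\<epsilon> > 0" "\<And>t. 0 < t \<Longrightarrow> t < \<epsilon> \<Longrightarrow> f' t > 0"
    and x: "x > 0"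
  shows "f x > 0"
proof -
  define y where "y = min x (\<epsilon> / 2)"
  have y: "0 < y" "y \<le> x" "y < \<epsilon>" using x near0 by (auto simp: y_def min_def)
  have "f 0 < f y"
    by (rule DERIV_pos_imp_increasing_open[OF \<open>0 < y\<close>])
      (use y der near0 in \<open>force intro: continuous_on_subset[OF cont]\<close>)+
  also have "f y \<le> f x"
  proof (rule DERIV_nonneg_imp_nondecreasing[OF \<open>y \<le> x\<close>])
    fix t assume "y \<le> t"
    hence "t > 0" using y by simp
    thus "\<exists>d. (f has_real_derivative d) (at t) \<and> d \<ge> 0" using der nonneg by blast
  qed
  finally show ?thesis using f0 by simp
qed

lemma set_integrable_lborel_if_dominated:
  fixes f g :: "real \<Rightarrow> real"
  assumes cont: "continuous_on {a<..<b} f" and g: "g integrable_on {a..b}"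
    and le: "\<And>t. t \<in> {a<..<b} \<Longrightarrow> \<bar>f t\<bar> \<le> g t"
  shows "set_integrable lborel {a<..<b} f"
proof -
  have "f absolutely_integrable_on {a<..<b}"
    by (rule measurable_bounded_by_integrable_imp_absolutely_integrable[where g = g])
      (use le g in \<open>auto intro!: continuous_imp_measurable_on_sets_lebesgue cont
        simp flip: integrable_on_Icc_iff_Ioo\<close>)
  thus ?thesis
    using borel_measurable_continuous_on_indicator[OF _ cont]
    unfolding set_integrable_def by (subst (asm) integrable_completion) auto
qed

section \<open>The Gamma function and Beta integrals of power series\<close>

lemma pos_not_nonpos_Ints: "x > 0 \<Longrightarrow> x \<notin> \<int>\<^sub>\<le>\<^sub>0" for x :: real
  using nonpos_Ints_nonpos[of x] by linarith

lemma Gamma_plus1_real: "x > 0 \<Longrightarrow> Gamma (x + 1) = x * Gamma (x :: real)"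
  by (intro Gamma_plus1 pos_not_nonpos_Ints)

lemma Gamma_legendre_duplication_real:
  fixes x :: real
  assumes "x > 0"
  shows "Gamma x * Gamma (x + 1/2) = 2 powr (1 - 2 * x) * sqrt pi * Gamma (2 * x)"
proof -
  have 1: "complex_of_real y \<notin> \<int>\<^sub>\<le>\<^sub>0" if "y > 0" for y
    using pos_not_nonpos_Ints[OF that] by (simp add: of_real_in_nonpos_Ints_iff)
  have "complex_of_real (Gamma x * Gamma (x + 1/2))
          = Gamma (of_real x) * Gamma (of_real x + 1/2)"
    by (simp flip: Gamma_complex_of_real)
  also have "\<dots> = exp ((1 - 2 * of_real x) * of_real (ln 2)) * of_real (sqrt pi) * Gamma (2 * of_real x)"
    using 1[of x] 1[of "x + 1/2"] assms by (intro Gamma_legendre_duplication) auto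
  also have "\<dots> = complex_of_real (2 powr (1 - 2 * x) * sqrt pi * Gamma (2 * x))"
  proof -
    have "exp ((1 - 2 * of_real x) * of_real (ln 2)) = complex_of_real (2 powr (1 - 2 * x))"
      by (simp add: powr_def flip: exp_of_real)
    moreover have "Gamma (2 * complex_of_real x) = of_real (Gamma (2 * x))"
      by (simp flip: Gamma_complex_of_real)
    ultimately show ?thesis by simp
  qed
  finally show ?thesis by (simp only: of_real_eq_iff)
qed

text \<open>
  This turns quotients of Gamma values into binomial coefficients, to which the Vandermonde
  convolution applies.
\<close>

lemma gbinomial_conv_Gamma:
  fixes z :: real
  assumes "z - real n + 1 > 0"
  shows "z gchoose n = Gamma (z + 1) / (fact n * Gamma (z - real n + 1))"
proof -
  have "z - real n + 1 \<notin> \<int>\<^sub>\<le>\<^sub>0" using assms by (rule pos_not_nonpos_Ints)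
  thus ?thesis
    by (simp add: gbinomial_pochhammer' pochhammer_Gamma add_ac)
qed

text \<open>
  Multiplying the coefficients of an entire function \<open>S\<close> by Beta values is a fractional
  integration: since \<open>Beta (n + p) q\<close> is the integral of \<open>t\<^bsup>n+p-1\<^esup> (1 - t)\<^bsup>q-1\<^esup>\<close> over \<open>[0, 1]\<close>,
  the new series is the integral of \<open>t\<^bsup>p-1\<^esup> (1 - t)\<^bsup>q-1\<^esup> S(t z)\<close>. It inherits positivity from \<open>S\<close>.
\<close>

lemma powser_Beta_pos:
  fixes c :: "nat \<Rightarrow> real"
  assumes summable: "\<And>y. summable (\<lambda>n. c n * y ^ n)"
    and nonneg: "\<And>y. y \<ge> 0 \<Longrightarrow> (\<Sum>n. c n * y ^ n) \<ge> 0"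
    and c0: "c 0 > 0" and p: "p > 0" and q: "q > 0" and z: "z \<ge> 0"
  shows "(\<Sum>n. c n * Beta (real n + p) q * z ^ n) > 0"
proof -
  define w where "w = (\<lambda>t::real. t powr (p - 1) * (1 - t) powr (q - 1))"
  define S where "S = (\<lambda>y. \<Sum>n. c n * y ^ n)"
  define f where "f = (\<lambda>n t. indicator {0..1} t * (w t * (c n * (t * z) ^ n)))"
  \<comment> \<open>At \<open>t = 0\<close> both sides vanish, since \<open>0 powr a = 0\<close> for every \<open>a\<close>.\<close>
  have wint: "((\<lambda>t. w t * t ^ n) has_integral Beta (real n + p) q) {0..1}" for n
  proof (rule has_integral_eq[OF _ has_integral_Beta_real])
    fix t :: real assume "t \<in> {0..1}"
    thus "t powr (real n + p - 1) * (1 - t) powr (q - 1) = w t * t ^ n"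
      using powr_add[of t "real n" "p - 1"]
      by (cases "t = 0") (auto simp: w_def powr_realpow add_diff_eq)
  qed (use p q in auto)
  have absint: "set_integrable lborel {0..1} (\<lambda>t. w t * t ^ n)" for n
  proof -
    have "(\<lambda>t. w t * t ^ n) absolutely_integrable_on {0..1}"
      using wint by (intro nonnegative_absolutely_integrable_1) (auto simp: w_def)
    thus ?thesis unfolding set_integrable_def
      by (subst (asm) integrable_completion) (auto simp: w_def)
  qed
  have wint': "(LINT t|lborel. indicator {0..1} t * (w t * t ^ n)) = Beta (real n + p) q" for n
    using set_borel_integral_eq_integral(2)[OF absint[of n]] wint[of n]
    by (simp add: set_lebesgue_integral_def integral_unique)
  have f_eq: "f n = (\<lambda>t. (c n * z ^ n) * (indicator {0..1} t * (w t * t ^ n)))" for n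
    by (auto simp: f_def power_mult_distrib fun_eq_iff)
  have fint: "integrable lborel (f n)" for n
    unfolding f_eq using absint[of n] by (intro integrable_mult_right) (simp add: set_integrable_def)
  have fnorm: "(LINT t|lborel. norm (f n t)) = \<bar>c n * z ^ n\<bar> * Beta (real n + p) q" for n
  proof -
    have "(\<lambda>t. norm (f n t)) = (\<lambda>t. \<bar>c n * z ^ n\<bar> * (indicator {0..1} t * (w t * t ^ n)))"
      by (auto simp: f_eq fun_eq_iff abs_mult w_def indicator_def)
    thus ?thesis by (simp add: wint')
  qed
  have abs: "summable (\<lambda>n. \<bar>c n * y ^ n\<bar>)" for y
    using powser_insidea[OF summable[of "\<bar>y\<bar> + 1"], of y] by simp
  have Beta_le: "\<bar>Beta (real n + p) q\<bar> \<le> Beta p q" for n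
  proof -
    have "Beta (real n + p) q \<le> Beta p q"
      using has_integral_le[OF wint[of n] wint[of 0, simplified]]
      by (fastforce simp: w_def intro!: mult_right_le_one_le power_le_one)
    moreover have "Beta (real n + p) q \<ge> 0"
      using wint[of n] by (rule has_integral_nonneg) (auto simp: w_def)
    ultimately show ?thesis by simp
  qed
  have sm: "summable (\<lambda>n. LINT t|lborel. norm (f n t))"
    unfolding fnorm
    by (rule summable_comparison_test[OF _ summable_mult2[OF abs[of z], of "Beta p q"]])
      (use Beta_le in \<open>auto simp: abs_mult intro!: mult_left_mono exI[of _ 0]\<close>)
  have smx: "summable (\<lambda>n. norm (f n t))" for t
    using summable_mult[OF abs[of "t * z"], of "\<bar>indicator {0..1} t * w t\<bar>"]
    by (simp add: f_def abs_mult mult_ac)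
  have sumf: "(\<Sum>n. f n t) = indicator {0..1} t * (w t * S (t * z))" for t
    unfolding f_def S_def using summable[of "t * z"] by (simp add: suminf_mult summable_mult)
  have res: "(\<lambda>n. LINT t|lborel. f n t) sums (LINT t|lborel. (\<Sum>n. f n t))"
    "integrable lborel (\<lambda>t. \<Sum>n. f n t)"
    using fint sm smx by (auto intro!: sums_integral integrable_suminf)
  define I where "I = (LINT t|lborel. (\<Sum>n. f n t))"
  have "I = (\<Sum>n. c n * Beta (real n + p) q * z ^ n)"
  proof -
    have "integral\<^sup>L lborel (f n) = c n * Beta (real n + p) q * z ^ n" for n
      unfolding f_eq by (subst integral_mult_right_zero) (simp add: wint')
    thus ?thesis using res(1) by (simp add: I_def sums_iff)
  qed
  moreover have "I > 0"
  proof -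
    have si: "set_integrable lborel {0..1} (\<lambda>t. w t * S (t * z))"
      using res(2) unfolding sumf set_integrable_def by simp
    have hi: "((\<lambda>t. w t * S (t * z)) has_integral I) {0..1}"
      using set_borel_integral_eq_integral[OF si]
      by (simp add: I_def sumf set_lebesgue_integral_def has_integral_iff)
    have contS: "isCont S y" for y
      unfolding S_def by (rule isCont_powser_converges_everywhere[OF summable])
    have "\<forall>\<^sub>F t in at_right 0. S (t * z) > 0"
    proof (rule order_tendstoD)
      have "((\<lambda>t. S (t * z)) \<longlongrightarrow> S (0 * z)) (at_right 0)"
        by (rule isCont_tendsto_compose[OF contS]) (auto intro!: tendsto_eq_intros)
      thus "((\<lambda>t. S (t * z)) \<longlongrightarrow> S 0) (at_right 0)" by simp
      show "S 0 > 0" using c0 by (simp add: S_def)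
    qed
    moreover have "\<forall>\<^sub>F t in at_right (0::real). t \<in> {0<..<1}"
      by (rule eventually_at_right_real) simp
    ultimately have "\<forall>\<^sub>F t in at_right 0. S (t * z) > 0 \<and> t \<in> {0<..<1}"
      by (rule eventually_conj)
    then obtain t where t: "S (t * z) > 0" "t \<in> {0<..<1}"
      using eventually_happens'[OF trivial_limit_at_right_real] by blast
    show ?thesis
    proof (rule integral_pos_if_continuous_nonneg[OF hi _ _ t(2)])
      have "continuous_on {0<..<1} (\<lambda>t. S (t * z))"
        by (rule continuous_on_compose2[OF continuous_at_imp_continuous_on, of UNIV])
          (auto intro!: contS continuous_intros)
      moreover have "continuous_on {0<..<1} w"
        unfolding w_def by (intro continuous_intros) auto
      ultimately show "continuous_on {0<..<1} (\<lambda>t. w t * S (t * z))"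
        by (intro continuous_on_mult)
      show "w t * S (t * z) \<ge> 0" if "t \<in> {0<..<1}" for t
      proof -
        have "S (t * z) \<ge> 0"
          unfolding S_def by (rule nonneg) (use that z in auto)
        thus ?thesis by (simp add: w_def)
      qed
      show "w t * S (t * z) > 0" using t by (auto simp: w_def)
    qed
  qed
  ultimately show ?thesis by simp
qed

section \<open>Series for the Bessel function and its moments\<close>

definition bessel_coeff :: "real \<Rightarrow> nat \<Rightarrow> real" where
  "bessel_coeff c k = (-1) ^ k / (fact k * Gamma (real k + c))"

text \<open>
  The Bessel-Clifford function: the entire factor of \<open>J\<^bsub>c-1\<^esub>\<close> that is left when the power
  singularity at the origin is split off, as a function of \<open>z = t\<^sup>2 / 4\<close>.
\<close>

definition bessel_clifford :: "real \<Rightarrow> real \<Rightarrow> real" where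
  "bessel_clifford c z = (\<Sum>k. bessel_coeff c k * z ^ k)"

text \<open>
  The entire factor of the integral of \<open>t\<^sup>\<alpha> J\<^sub>\<beta>(t)\<close> for \<open>r = \<alpha> + \<beta> + 1\<close> and \<open>c = \<beta> + 1\<close>: integrating
  \<open>t\<^bsup>2k+r-1\<^esup>\<close> produces the denominators \<open>2 k + r\<close>.
\<close>

definition moment_series :: "real \<Rightarrow> real \<Rightarrow> real \<Rightarrow> real" where
  "moment_series r c z = (\<Sum>k. bessel_coeff c k / (2 * real k + r) * z ^ k)"

text \<open>
  The integral of \<open>t\<^sup>\<alpha> J\<^sub>\<beta>(t)\<close> over \<open>(0, x)\<close>, defined by its series so that its behaviour at the
  origin is explicit; \<open>has_integral_bessel_moment\<close> connects it with the integral.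
\<close>

definition bessel_moment :: "real \<Rightarrow> real \<Rightarrow> real \<Rightarrow> real" where
  "bessel_moment \<alpha> \<beta> x =
     2 powr - \<beta> * (x powr (\<alpha> + \<beta> + 1) * moment_series (\<alpha> + \<beta> + 1) (\<beta> + 1) (x\<^sup>2 / 4))"

lemma summable_bessel_coeff:
  assumes c: "c > 0"
  shows "summable (\<lambda>k. bessel_coeff c k * y ^ k)"
proof (rule summable_ratio_test)
  fix k assume k: "k \<ge> nat \<lceil>2 * \<bar>y\<bar>\<rceil> + 1"
  have "bessel_coeff c (Suc k) * y ^ Suc k
      = (- y / (real (Suc k) * (real k + c))) * (bessel_coeff c k * y ^ k)"
    using Gamma_plus1_real[of "real k + c"] c by (simp add: bessel_coeff_def add_ac mult_ac)
  moreover have "\<bar>- y / (real (Suc k) * (real k + c))\<bar> \<le> 1 / 2"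
  proof -
    have "2 * \<bar>y\<bar> \<le> real (nat \<lceil>2 * \<bar>y\<bar>\<rceil>)" by (rule real_nat_ceiling_ge)
    also have "\<dots> \<le> real (Suc k) * 1" using k by simp
    also have "\<dots> \<le> real (Suc k) * (real k + c)"
      using k c by (intro mult_left_mono) auto
    finally show ?thesis using c by (simp add: abs_mult divide_le_eq)
  qed
  ultimately show "norm (bessel_coeff c (Suc k) * y ^ Suc k)
      \<le> 1 / 2 * norm (bessel_coeff c k * y ^ k)"
    unfolding real_norm_def by (simp only: abs_mult) (intro mult_right_mono; simp)
qed simp

lemma diffs_bessel_coeff: "diffs (bessel_coeff c) k = - bessel_coeff (c + 1) k"
  by (simp add: diffs_def bessel_coeff_def add_ac del: of_nat_Suc) (simp add: field_simps)

lemma has_real_derivative_bessel_clifford: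
  assumes "c > 0"
  shows "(bessel_clifford c has_real_derivative - bessel_clifford (c + 1) z) (at z)"
proof -
  have "summable (\<lambda>k. bessel_coeff (c + 1) k * z ^ k)"
    using assms by (intro summable_bessel_coeff) simp
  thus ?thesis
    using termdiffs_strong_converges_everywhere[OF summable_bessel_coeff[OF assms], of z]
    by (simp add: bessel_clifford_def[abs_def] diffs_bessel_coeff suminf_minus)
qed

text \<open>
  The right-hand side is the Euler operator \<open>z d/dz\<close> applied to the series. Through it, relations
  between coefficients that are linear in \<open>k\<close> become differential equations.
\<close>

lemma powser_times_index:
  fixes a :: "nat \<Rightarrow> real"
  assumes "\<And>y. summable (\<lambda>k. a k * y ^ k)"
  shows "(\<lambda>k. real k * a k * z ^ k) sums (z * (\<Sum>k. diffs a k * z ^ k))"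
proof -
  have "summable (\<lambda>k. diffs a k * z ^ k)"
    using assms by (intro termdiff_converges_all)
  from sums_mult[OF diffs_equiv[OF this], of z]
  show ?thesis
  proof (rule sums_cong[THEN iffD1, rotated])
    show "z * (real k * a k * z ^ (k - Suc 0)) = real k * a k * z ^ k" for k
      by (cases k) auto
  qed
qed

text \<open>
  The three-term recurrence of the Bessel functions. Because differentiation shifts \<open>c\<close> by one,
  it is also their differential equation. It holds since \<open>\<Gamma>(k + c + 1) = (k + c) \<Gamma>(k + c)\<close>
  writes the \<open>k\<close>-th coefficient for \<open>c\<close> as \<open>k + c\<close> times the one for \<open>c + 1\<close>.
\<close>

lemma bessel_clifford_rec:
  assumes "c > 0"
  shows "bessel_clifford c z = c * bessel_clifford (c + 1) z - z * bessel_clifford (c + 2) z"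
proof -
  have *: "summable (\<lambda>k. bessel_coeff d k * z ^ k)" if "d > 0" for d z
    using that by (rule summable_bessel_coeff)
  have coeff: "bessel_coeff c k = c * bessel_coeff (c + 1) k + real k * bessel_coeff (c + 1) k" for k
  proof -
    have "Gamma (real k + (c + 1)) = (real k + c) * Gamma (real k + c)"
      using Gamma_plus1_real[of "real k + c"] assms by (simp add: add_ac)
    hence "bessel_coeff c k = (real k + c) * bessel_coeff (c + 1) k"
      using assms by (simp add: bessel_coeff_def)
    thus ?thesis by (simp add: algebra_simps)
  qed
  have "(\<lambda>k. c * (bessel_coeff (c + 1) k * z ^ k) + real k * bessel_coeff (c + 1) k * z ^ k) sums
          (c * bessel_clifford (c + 1) z + z * (\<Sum>k. diffs (bessel_coeff (c + 1)) k * z ^ k))"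
    using assms
    by (intro sums_add sums_mult powser_times_index)
      (auto simp: bessel_clifford_def intro!: summable_sums *)
  moreover have "(\<Sum>k. diffs (bessel_coeff (c + 1)) k * z ^ k) = - bessel_clifford (c + 2) z"
    using *[of "c + 2" z] assms
    by (simp add: diffs_bessel_coeff bessel_clifford_def suminf_minus add_ac)
  ultimately show ?thesis
    by (simp add: bessel_clifford_def coeff sums_iff algebra_simps)
qed

lemma bessel_J_conv_clifford:
  assumes "\<beta> > -1" "t > 0"
  shows "bessel_J \<beta> t = (t / 2) powr \<beta> * bessel_clifford (\<beta> + 1) (t\<^sup>2 / 4)"
proof -
  have "(t / 2) powr (2 * real k + \<beta>) = (t / 2) powr \<beta> * (t\<^sup>2 / 4) ^ k" for k
    using assms powr_realpow[of "t / 2" "2 * k"]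
    by (simp add: powr_add power_mult power_divide)
  thus ?thesis
    using summable_bessel_coeff[of "\<beta> + 1" "t\<^sup>2 / 4"] assms
    by (simp add: bessel_J_def bessel_clifford_def bessel_coeff_def add_ac suminf_mult
        flip: mult.assoc) (simp add: mult_ac flip: suminf_mult)
qed

lemma summable_moment_coeff:
  assumes "r > 0" "c > 0"
  shows "summable (\<lambda>k. bessel_coeff c k / (2 * real k + r) * y ^ k)"
proof (rule summable_comparison_test)
  have "summable (\<lambda>k. \<bar>bessel_coeff c k * y ^ k\<bar>)"
    using powser_insidea[OF summable_bessel_coeff[OF assms(2)], of y "\<bar>y\<bar> + 1"] by simp
  thus "summable (\<lambda>k. \<bar>bessel_coeff c k * y ^ k\<bar> / r)" by (rule summable_divide)
  show "\<exists>N. \<forall>k\<ge>N. norm (bessel_coeff c k / (2 * real k + r) * y ^ k)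
          \<le> \<bar>bessel_coeff c k * y ^ k\<bar> / r"
    using assms by (auto simp: abs_mult intro!: frac_le)
qed

lemma isCont_moment_series:
  assumes "r > 0" "c > 0"
  shows "isCont (moment_series r c) z"
  unfolding moment_series_def
  by (rule isCont_powser_converges_everywhere[OF summable_moment_coeff[OF assms]])

lemma moment_series_0: "moment_series r c 0 = 1 / (r * Gamma c)"
  unfolding moment_series_def by (subst powser_zero) (simp add: bessel_coeff_def)

text \<open>
  The operator \<open>r + 2 z d/dz\<close> multiplies the \<open>k\<close>-th coefficient by \<open>2 k + r\<close>, which cancels the
  denominator coming from the integration. In terms of \<open>x\<close> with \<open>z = x\<^sup>2 / 4\<close>, it is
  the derivative of \<open>x\<^sup>r\<close> times the series, divided by \<open>x\<^bsup>r-1\<^esup>\<close>.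
\<close>

lemma moment_series_deriv:
  assumes "r > 0" "c > 0"
  obtains D where "(moment_series r c has_real_derivative D) (at z)"
    and "r * moment_series r c z + 2 * z * D = bessel_clifford c z"
proof
  let ?a = "\<lambda>k. bessel_coeff c k / (2 * real k + r)"
  let ?D = "\<Sum>k. diffs ?a k * z ^ k"
  note sm = summable_moment_coeff[OF assms]
  show "(moment_series r c has_real_derivative ?D) (at z)"
    unfolding moment_series_def by (rule termdiffs_strong_converges_everywhere[OF sm])
  have "(\<lambda>k. r * (?a k * z ^ k) + 2 * (real k * ?a k * z ^ k)) sums
          (r * moment_series r c z + 2 * (z * ?D))"
    by (intro sums_add sums_mult powser_times_index sm)
      (simp_all only: moment_series_def summable_sums sm)
  moreover have "r * (?a k * z ^ k) + 2 * (real k * ?a k * z ^ k) = bessel_coeff c k * z ^ k" for k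
  proof -
    have "r * (?a k * z ^ k) + 2 * (real k * ?a k * z ^ k) = ((2 * real k + r) * ?a k) * z ^ k"
      by (simp only: ring_distribs mult_ac)
    thus ?thesis using assms by simp
  qed
  ultimately show "r * moment_series r c z + 2 * z * ?D = bessel_clifford c z"
    by (simp add: bessel_clifford_def sums_iff mult.assoc)
qed

lemma bessel_moment_at_0 [simp]: "bessel_moment \<alpha> \<beta> 0 = 0"
  by (simp add: bessel_moment_def)

lemma continuous_on_moment_series [continuous_intros]:
  assumes "continuous_on A f" "r > 0" "c > 0"
  shows "continuous_on A (\<lambda>x. moment_series r c (f x))"
  using continuous_on_compose2[OF continuous_at_imp_continuous_on assms(1), of UNIV "moment_series r c"]
    isCont_moment_series[OF assms(2,3)] by auto

lemma continuous_on_bessel_moment: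
  assumes "\<beta> > -1" "\<alpha> + \<beta> > -1"
  shows "continuous_on {0..} (bessel_moment \<alpha> \<beta>)"
  unfolding bessel_moment_def using assms
  by (intro continuous_intros continuous_on_powr') auto

lemma has_real_derivative_bessel_moment:
  assumes "\<beta> > -1" "\<alpha> + \<beta> > -1" "x > 0"
  shows "(bessel_moment \<alpha> \<beta> has_real_derivative x powr \<alpha> * bessel_J \<beta> x) (at x)"
proof -
  define r where "r = \<alpha> + \<beta> + 1"
  have r: "r > 0" "\<beta> + 1 > 0" using assms by (auto simp: r_def)
  obtain D where D: "(moment_series r (\<beta> + 1) has_real_derivative D) (at (x\<^sup>2 / 4))"
    and D_eq: "r * moment_series r (\<beta> + 1) (x\<^sup>2 / 4) + 2 * (x\<^sup>2 / 4) * D = bessel_clifford (\<beta> + 1) (x\<^sup>2 / 4)"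
    using moment_series_deriv[OF r] by metis
  have "((\<lambda>x. 2 powr - \<beta> * (x powr r * moment_series r (\<beta> + 1) (x\<^sup>2 / 4))) has_real_derivative
      2 powr - \<beta> * ((r * x powr (r - 1)) * moment_series r (\<beta> + 1) (x\<^sup>2 / 4) + (D * (x / 2)) * x powr r)) (at x)"
    using assms
    by (intro DERIV_cmult DERIV_mult has_real_derivative_powr DERIV_chain2[where g = "\<lambda>x. x\<^sup>2 / 4", OF D])
      (auto intro!: derivative_eq_intros)
  also have "x powr r = x powr (r - 1) * x"
    using assms by (simp add: powr_mult_base powr_diff)
  also have "2 powr - \<beta> * ((r * x powr (r - 1)) * moment_series r (\<beta> + 1) (x\<^sup>2 / 4)
        + (D * (x / 2)) * (x powr (r - 1) * x))
      = 2 powr - \<beta> * x powr (r - 1) * (r * moment_series r (\<beta> + 1) (x\<^sup>2 / 4) + 2 * (x\<^sup>2 / 4) * D)"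
    by (simp add: algebra_simps power2_eq_square)
  also have "\<dots> = x powr \<alpha> * bessel_J \<beta> x"
    unfolding D_eq using assms
    by (simp add: r_def bessel_J_conv_clifford powr_add powr_divide powr_minus divide_simps)
  finally show ?thesis by (simp add: bessel_moment_def[abs_def] r_def)
qed

lemma bessel_moment_pos_near_0:
  assumes "\<beta> > -1" "\<alpha> + \<beta> > -1"
  obtains \<epsilon> where "\<epsilon> > 0" "\<And>x. 0 < x \<Longrightarrow> x < \<epsilon> \<Longrightarrow> bessel_moment \<alpha> \<beta> x > 0"
proof -
  let ?M = "moment_series (\<alpha> + \<beta> + 1) (\<beta> + 1)"
  have "((\<lambda>x. ?M (x\<^sup>2 / 4)) \<longlongrightarrow> ?M (0\<^sup>2 / 4)) (at_right 0)"
    using assms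
    by (intro isCont_tendsto_compose[OF isCont_moment_series] tendsto_intros) auto
  moreover have "?M (0\<^sup>2 / 4) > 0" using assms by (simp add: moment_series_0)
  ultimately have "\<forall>\<^sub>F x in at_right 0. ?M (x\<^sup>2 / 4) > 0" by (rule order_tendstoD(1))
  then obtain \<epsilon> where "\<epsilon> > 0" "\<And>x. 0 < x \<Longrightarrow> x < \<epsilon> \<Longrightarrow> ?M (x\<^sup>2 / 4) > 0"
    unfolding eventually_at_right_field by auto
  thus ?thesis by (intro that[of \<epsilon>]) (auto simp: bessel_moment_def)
qed

section \<open>Moments as averages of squares\<close>

text \<open>
  The Taylor coefficients of the square of \<open>bessel_clifford (a + 1/2)\<close> at \<open>z / 4\<close>. Up to the
  constant factor, the series is the hypergeometric function 1F2 with parameters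
  \<open>a; 2 a, a + 1/2\<close> at \<open>- z\<close>.
\<close>

definition clifford_square_coeff :: "real \<Rightarrow> nat \<Rightarrow> real" where
  "clifford_square_coeff a k =
     2 powr (2 * a - 1) / sqrt pi *
     ((-1) ^ k * Gamma (real k + a) / (fact k * Gamma (real k + 2 * a) * Gamma (real k + a + 1/2)))"

text \<open>
  With \<open>m = a - 1/2 + k\<close>, each product of two coefficients is a product of the binomial
  coefficients of \<open>m\<close> over \<open>i\<close> and over \<open>k - i\<close>, up to a factor that is free of \<open>i\<close>. The Vandermonde
  convolution sums them to the binomial coefficient of \<open>2 m\<close> over \<open>k\<close>, and the duplication
  formula splits the resulting \<open>\<Gamma>(2 (k + a))\<close>.
\<close>

lemma bessel_coeff_convolution:
  fixes a :: real
  assumes a: "a > 0"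
  shows "(\<Sum>i\<le>k. bessel_coeff (a + 1/2) i * bessel_coeff (a + 1/2) (k - i)) / 4 ^ k
           = clifford_square_coeff a k"
proof -
  define m where "m = a - 1/2 + real k"
  define N where "N = real k + a"
  have N: "N > 0" using a by (simp add: N_def)
  have m: "m + 1 = N + 1/2" "m + m + 1 = 2 * N" "m + m - real k + 1 = real k + 2 * a"
    by (simp_all add: m_def N_def)
  have term_eq: "bessel_coeff (a + 1/2) i * bessel_coeff (a + 1/2) (k - i)
      = (-1) ^ k / (Gamma (m + 1))\<^sup>2 * ((m gchoose i) * (m gchoose (k - i)))" if "i \<le> k" for i
  proof -
    have "m gchoose i = Gamma (m + 1) / (fact i * Gamma (real (k - i) + (a + 1/2)))"
      using a that by (subst gbinomial_conv_Gamma) (auto simp: m_def of_nat_diff algebra_simps)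
    moreover have "m gchoose (k - i) = Gamma (m + 1) / (fact (k - i) * Gamma (real i + (a + 1/2)))"
      using a that by (subst gbinomial_conv_Gamma) (auto simp: m_def of_nat_diff algebra_simps)
    moreover have "Gamma (m + 1) > 0" using N unfolding m by simp
    moreover have "(-1) ^ i * (-1) ^ (k - i) = ((-1) ^ k :: real)"
      using that by (simp flip: power_add)
    ultimately show ?thesis
      by (simp add: bessel_coeff_def power2_eq_square mult_ac)
  qed
  have "(\<Sum>i\<le>k. bessel_coeff (a + 1/2) i * bessel_coeff (a + 1/2) (k - i))
      = (-1) ^ k / (Gamma (m + 1))\<^sup>2 * (\<Sum>i=0..k. (m gchoose i) * (m gchoose (k - i)))"
    by (simp add: term_eq sum_distrib_left atMost_atLeast0)
  also have "\<dots> = (-1) ^ k / (Gamma (m + 1))\<^sup>2 * (m + m gchoose k)"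
    by (simp only: gbinomial_Vandermonde)
  also have "(m + m gchoose k) = Gamma (2 * N) / (fact k * Gamma (real k + 2 * a))"
  proof -
    have "m + m - real k + 1 > 0" using a unfolding m by simp
    from gbinomial_conv_Gamma[OF this] show ?thesis by (simp only: m)
  qed
  also have "Gamma (2 * N) = 2 powr (2 * a - 1) * 4 ^ k * Gamma N * Gamma (N + 1/2) / sqrt pi"
  proof -
    have "2 powr (1 - 2 * N) * (2 powr (2 * a - 1) * 4 ^ k) = 1"
    proof -
      have "(4::real) ^ k = 2 powr (2 * real k)"
        by (simp add: powr_realpow flip: powr_powr)
      thus ?thesis by (simp add: N_def flip: powr_add)
    qed
    hence "Gamma (2 * N) = (2 powr (1 - 2 * N) * (2 powr (2 * a - 1) * 4 ^ k)) * Gamma (2 * N)"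
      by simp
    also have "\<dots> = 2 powr (2 * a - 1) * 4 ^ k * (2 powr (1 - 2 * N) * sqrt pi * Gamma (2 * N)) / sqrt pi"
      by simp
    also have "\<dots> = 2 powr (2 * a - 1) * 4 ^ k * (Gamma N * Gamma (N + 1/2)) / sqrt pi"
      by (simp only: Gamma_legendre_duplication_real[OF N])
    finally show ?thesis by (simp only: mult.assoc)
  qed
  finally have "(\<Sum>i\<le>k. bessel_coeff (a + 1/2) i * bessel_coeff (a + 1/2) (k - i)) / 4 ^ k
      = 2 powr (2 * a - 1) / sqrt pi *
        ((-1) ^ k * Gamma N / (fact k * Gamma (real k + 2 * a) * Gamma (N + 1/2)))"
    using Gamma_real_pos[of "N + 1/2"] N unfolding m(1)
    by (simp add: power2_eq_square mult_ac del: Gamma_real_pos)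
  thus ?thesis by (simp add: clifford_square_coeff_def N_def)
qed

lemma bessel_clifford_square_sums:
  assumes a: "a > 0"
  shows "(\<lambda>k. clifford_square_coeff a k * z ^ k) sums (bessel_clifford (a + 1/2) (z / 4))\<^sup>2"
proof -
  let ?b = "\<lambda>k. bessel_coeff (a + 1/2) k * (z / 4) ^ k"
  have "a + 1/2 > 0" using a by simp
  hence "summable (\<lambda>k. norm (?b k))"
    using powser_insidea[OF summable_bessel_coeff, of "a + 1/2" "z / 4" "\<bar>z / 4\<bar> + 1"] by simp
  from Cauchy_product_sums[OF this this]
  have "(\<lambda>k. \<Sum>i\<le>k. ?b i * ?b (k - i)) sums (bessel_clifford (a + 1/2) (z / 4))\<^sup>2"
    by (simp add: bessel_clifford_def power2_eq_square)
  also have "(\<lambda>k. \<Sum>i\<le>k. ?b i * ?b (k - i)) = (\<lambda>k. clifford_square_coeff a k * z ^ k)"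
  proof
    fix k
    have "(\<Sum>i\<le>k. ?b i * ?b (k - i))
        = (\<Sum>i\<le>k. bessel_coeff (a + 1/2) i * bessel_coeff (a + 1/2) (k - i)) * (z / 4) ^ k"
      unfolding sum_distrib_right
      by (intro sum.cong) (auto simp: mult_ac simp flip: power_add)
    thus "(\<Sum>i\<le>k. ?b i * ?b (k - i)) = clifford_square_coeff a k * z ^ k"
      by (simp add: power_divide flip: bessel_coeff_convolution[OF a])
  qed
  finally show ?thesis .
qed

lemma Beta_clifford_square_pos:
  assumes a: "a > 0" and "p > 0" "q > 0" "z \<ge> 0"
  shows "(\<Sum>k. clifford_square_coeff a k * Beta (real k + p) q * z ^ k) > 0"
proof (rule powser_Beta_pos)
  show "summable (\<lambda>k. clifford_square_coeff a k * y ^ k)" for y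
    using bessel_clifford_square_sums[OF a] by (rule sums_summable)
  show "(\<Sum>k. clifford_square_coeff a k * y ^ k) \<ge> 0" for y
    using bessel_clifford_square_sums[OF a, of y] by (simp add: sums_iff)
  show "clifford_square_coeff a 0 > 0"
    using a by (auto simp: clifford_square_coeff_def intro!: divide_pos_pos mult_pos_pos)
qed (use assms in auto)

text \<open>
  The common pattern of the two following cases: a moment series whose coefficients are, up to
  a constant, those of the square multiplied by Beta values.
\<close>

lemma moment_series_pos_if_multiple:
  assumes a: "a > 0" and "p > 0" "q > 0" "z \<ge> 0" and C: "C > 0"
    and eq: "\<And>k. clifford_square_coeff a k * Beta (real k + p) q = C * (bessel_coeff c k / (2 * real k + r))"
    and rc: "r > 0" "c > 0"
  shows "moment_series r c z > 0"
proof -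
  have "0 < (\<Sum>k. C * (bessel_coeff c k / (2 * real k + r) * z ^ k))"
    using Beta_clifford_square_pos[OF assms(1-4)] unfolding eq by (simp only: mult.assoc)
  also have "\<dots> = C * moment_series r c z"
    unfolding moment_series_def by (rule suminf_mult[OF summable_moment_coeff[OF rc]])
  finally show ?thesis using C by (simp add: zero_less_mult_iff)
qed

text \<open>
  For \<open>\<alpha> = 0\<close> the lower parameter \<open>\<beta> + 1\<close> equals \<open>2 a\<close>, and the Beta values with \<open>p = a + 1/2\<close>
  and \<open>q = 1/2\<close> replace \<open>\<Gamma>(k + a + 1/2)\<close> by \<open>\<Gamma>(k + a + 1) = (k + a) \<Gamma>(k + a)\<close>.
\<close>

lemma bessel_moment_exponent_0_pos:
  assumes "\<beta> > -1" "x > 0"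
  shows "bessel_moment 0 \<beta> x > 0"
proof -
  define a where "a = (\<beta> + 1) / 2"
  have a: "a > 0" using assms by (simp add: a_def)
  have "moment_series (2 * a) (2 * a) (x\<^sup>2 / 4) > 0"
  proof (rule moment_series_pos_if_multiple[where p = "a + 1/2" and q = "1/2"
        and C = "2 powr (2 * a - 1) * 2"])
    fix k
    define N where "N = real k + a"
    have pos: "Gamma (N + 1) = N * Gamma N" "N > 0" "Gamma N \<noteq> 0" "Gamma (N + 1/2) \<noteq> 0"
      using a by (auto simp: N_def intro!: Gamma_plus1_real Gamma_real_pos less_imp_neq[THEN not_sym])
    have eqs: "2 * real k + 2 * a = 2 * N" "real k + (a + 1/2) = N + 1/2" "real k + a + 1/2 = N + 1/2"
      "N + 1/2 + 1/2 = N + 1" "real k + a = N"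
      by (simp_all add: N_def)
    show "clifford_square_coeff a k * Beta (real k + (a + 1/2)) (1/2)
        = 2 powr (2 * a - 1) * 2 * (bessel_coeff (2 * a) k / (2 * real k + 2 * a))"
      unfolding clifford_square_coeff_def bessel_coeff_def Beta_def eqs pos(1)
      using pos by (simp add: Gamma_one_half_real)
  qed (use a in auto)
  moreover have "2 * a = \<beta> + 1" by (simp add: a_def)
  ultimately show ?thesis using assms by (simp add: bessel_moment_def)
qed

text \<open>
  For \<open>\<alpha> = \<beta>\<close> the lower parameter \<open>\<beta> + 1\<close> equals \<open>a + 1/2\<close>, and the Beta values with \<open>p = 2 a\<close>
  and \<open>q = 1 - a\<close> replace \<open>\<Gamma>(k + 2 a)\<close> by \<open>\<Gamma>(k + a + 1)\<close>. Integrability of the Beta kernel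
  is the condition \<open>a < 1\<close>, that is \<open>\<beta> < 1/2\<close>.
\<close>

lemma bessel_moment_diagonal_pos:
  assumes "\<beta> > -1/2" "\<beta> < 1/2" "x > 0"
  shows "bessel_moment \<beta> \<beta> x > 0"
proof -
  define a where "a = \<beta> + 1/2"
  have a: "a > 0" "a < 1" using assms by (auto simp: a_def)
  have "moment_series (2 * a) (a + 1/2) (x\<^sup>2 / 4) > 0"
  proof (rule moment_series_pos_if_multiple[where p = "2 * a" and q = "1 - a"
        and C = "2 powr (2 * a - 1) / sqrt pi * Gamma (1 - a) * 2"])
    fix k
    define N where "N = real k + a"
    have pos: "Gamma (N + 1) = N * Gamma N" "N > 0" "Gamma N \<noteq> 0" "Gamma (real k + 2 * a) \<noteq> 0"
      using a by (auto simp: N_def intro!: Gamma_plus1_real Gamma_real_pos less_imp_neq[THEN not_sym])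
    have eqs: "2 * real k + 2 * a = 2 * N" "real k + (a + 1/2) = N + 1/2" "real k + a + 1/2 = N + 1/2"
      "real k + 2 * a + (1 - a) = N + 1" "real k + a = N"
      by (simp_all add: N_def)
    show "clifford_square_coeff a k * Beta (real k + 2 * a) (1 - a)
        = 2 powr (2 * a - 1) / sqrt pi * Gamma (1 - a) * 2 *
          (bessel_coeff (a + 1/2) k / (2 * real k + 2 * a))"
      unfolding clifford_square_coeff_def bessel_coeff_def Beta_def eqs pos(1)
      using pos by simp
  qed (use a in auto)
  thus ?thesis using assms by (simp add: bessel_moment_def a_def add_ac)
qed

section \<open>The exponent one half\<close>

text \<open>
  The equation \<open>u'' + q u = 0\<close> with \<open>q = 1 - \<kappa> / t\<^sup>2\<close> has an increasing \<open>q\<close> because \<open>\<kappa> = \<beta>\<^sup>2 - 1/4\<close> is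
  positive. For \<open>U' = u\<close> this makes \<open>W = U u' - u\<^sup>2 / 2 + q U\<^sup>2 / 2\<close> nondecreasing from \<open>W(0) = 0\<close>,
  and the sign of \<open>W\<close> at a zero of \<open>U\<close> would be the wrong one. In the proof, \<open>f\<close> and \<open>g\<close> are
  the entire factors of \<open>J\<^sub>\<beta>\<close> and \<open>J\<^bsub>\<beta>+1\<^esub>\<close>, and \<open>v\<close> is \<open>u'\<close>.
\<close>

lemma bessel_moment_half_pos:
  assumes \<beta>: "\<beta> > 1/2" and x: "x > 0"
  shows "bessel_moment (1/2) \<beta> x > 0"
proof -
  define K where "K = 2 powr - \<beta>"
  define \<kappa> where "\<kappa> = \<beta>\<^sup>2 - 1/4"
  define f where "f = (\<lambda>t::real. bessel_clifford (\<beta> + 1) (t\<^sup>2 / 4))"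
  define g where "g = (\<lambda>t::real. bessel_clifford (\<beta> + 2) (t\<^sup>2 / 4))"
  define A where "A = (\<lambda>t::real. moment_series (\<beta> + 3/2) (\<beta> + 1) (t\<^sup>2 / 4))"
  define U where "U = bessel_moment (1/2) \<beta>"
  define u where "u = (\<lambda>t. K * (t powr (\<beta> + 1/2) * f t))"
  define v where "v = (\<lambda>t. K * ((\<beta> + 1/2) * t powr (\<beta> - 1/2) * f t - t powr (\<beta> + 3/2) * g t / 2))"
  define W where "W = (\<lambda>t. U t * v t - (u t)\<^sup>2 / 2 + (1 - \<kappa> / t\<^sup>2) * (U t)\<^sup>2 / 2)"
  have "\<beta>\<^sup>2 > (1/2)\<^sup>2" using \<beta> by (intro power_strict_mono) auto
  hence \<kappa>: "\<kappa> > 0" by (simp add: \<kappa>_def power2_eq_square)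
  have clifford_deriv: "((\<lambda>t. bessel_clifford c (t\<^sup>2 / 4)) has_real_derivative
      - (t / 2) * bessel_clifford (c + 1) (t\<^sup>2 / 4)) (at t)" if "c > 0" for c t
    by (rule DERIV_chain2[where g = "\<lambda>t. t\<^sup>2 / 4", THEN DERIV_cong,
          OF has_real_derivative_bessel_clifford[OF that]])
      (auto intro!: derivative_eq_intros)
  have df: "(f has_real_derivative - (t / 2) * g t) (at t)" for t
    unfolding f_def g_def using clifford_deriv[of "\<beta> + 1" t] \<beta> by (simp add: add_ac)
  \<comment> \<open>The recurrence eliminates the third Bessel function from \<open>g'\<close>; this is the differential equation.\<close>
  have dg: "(g has_real_derivative - 2 * ((\<beta> + 1) * g t - f t) / t) (at t)" if "t > 0" for t
  proof -
    have "t\<^sup>2 / 4 * bessel_clifford (\<beta> + 3) (t\<^sup>2 / 4) = (\<beta> + 1) * g t - f t"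
      using bessel_clifford_rec[of "\<beta> + 1" "t\<^sup>2 / 4"] \<beta> by (simp add: f_def g_def add_ac)
    hence "- (t / 2) * bessel_clifford (\<beta> + 3) (t\<^sup>2 / 4) = - 2 * ((\<beta> + 1) * g t - f t) / t"
      using that by (simp add: field_simps power2_eq_square)
    thus ?thesis
      unfolding g_def using clifford_deriv[of "\<beta> + 2" t] \<beta> by (simp add: add_ac)
  qed
  have dU: "(U has_real_derivative u t) (at t)" if "t > 0" for t
  proof -
    have "bessel_J \<beta> t = K * (t powr \<beta> * f t)"
      using that \<beta> by (simp add: bessel_J_conv_clifford K_def f_def powr_divide powr_minus field_simps)
    hence "t powr (1/2) * bessel_J \<beta> t = u t"
      by (simp add: u_def powr_add mult_ac)
    thus ?thesis
      using has_real_derivative_bessel_moment[of \<beta> "1/2" t] \<beta> that by (simp add: U_def)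
  qed
  have powr_shift: "t powr (\<beta> + 1/2) = t powr (\<beta> - 1/2) * t"
    "t powr (\<beta> + 3/2) = t powr (\<beta> - 1/2) * t\<^sup>2"
    "t powr (\<beta> - 3/2) = t powr (\<beta> - 1/2) / t" if "t > 0" for t
  proof -
    have "t powr (\<beta> + 3/2) = t powr ((\<beta> - 1/2) + 2)" "t powr (\<beta> + 1/2) = t powr ((\<beta> - 1/2) + 1)"
      "t powr (\<beta> - 3/2) = t powr ((\<beta> - 1/2) - 1)"
      by (simp_all add: algebra_simps)
    thus "t powr (\<beta> + 1/2) = t powr (\<beta> - 1/2) * t"
      "t powr (\<beta> + 3/2) = t powr (\<beta> - 1/2) * t\<^sup>2"
      "t powr (\<beta> - 3/2) = t powr (\<beta> - 1/2) / t"
      using that by (simp_all only: powr_add powr_diff) (simp_all flip: powr_numeral)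
  qed
  have du: "(u has_real_derivative v t) (at t)" if "t > 0" for t
  proof -
    have "(u has_real_derivative K * (((\<beta> + 1/2) * t powr (\<beta> + 1/2 - 1)) * f t
            + (- (t / 2) * g t) * t powr (\<beta> + 1/2))) (at t)"
      unfolding u_def by (intro DERIV_cmult DERIV_mult has_real_derivative_powr df that)
    also have "(((\<beta> + 1/2) * t powr (\<beta> + 1/2 - 1)) * f t + (- (t / 2) * g t) * t powr (\<beta> + 1/2))
        = (\<beta> + 1/2) * t powr (\<beta> - 1/2) * f t - t powr (\<beta> + 3/2) * g t / 2"
      using that by (simp add: powr_shift power2_eq_square)
    finally show ?thesis by (simp add: v_def)
  qed
  have dv: "(v has_real_derivative (\<kappa> / t\<^sup>2 - 1) * u t) (at t)" if "t > 0" for t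
  proof -
    have "(v has_real_derivative
        K * ((((\<beta> + 1/2) * ((\<beta> - 1/2) * t powr (\<beta> - 1/2 - 1))) * f t
              + (- (t / 2) * g t) * ((\<beta> + 1/2) * t powr (\<beta> - 1/2)))
            - (((\<beta> + 3/2) * t powr (\<beta> + 3/2 - 1)) * g t
              + (- 2 * ((\<beta> + 1) * g t - f t) / t) * t powr (\<beta> + 3/2)) / 2)) (at t)"
      unfolding v_def
      by (intro DERIV_cmult DERIV_diff DERIV_cdivide DERIV_mult has_real_derivative_powr df dg that)
    moreover have "\<beta> - 1/2 - 1 = \<beta> - 3/2" "\<beta> + 3/2 - 1 = \<beta> + 1/2" by simp_all
    ultimately show ?thesis
    proof (elim DERIV_cong, goal_cases)
      case 1
      show ?case
        unfolding 1 u_def \<kappa>_def powr_shift[OF that] using that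
        by (simp add: field_simps power2_eq_square)
    qed
  qed
  have dW: "(W has_real_derivative \<kappa> / t ^ 3 * (U t)\<^sup>2) (at t)" if "t > 0" for t
  proof -
    have "(W has_real_derivative
        u t * v t + (\<kappa> / t\<^sup>2 - 1) * u t * U t - (2 * u t * v t) / 2
          + ((2 * \<kappa> / t ^ 3) * (U t)\<^sup>2 + (2 * U t * u t) * (1 - \<kappa> / t\<^sup>2)) / 2) (at t)"
      unfolding W_def
      by (intro DERIV_add DERIV_diff DERIV_cdivide DERIV_mult dU du dv that)
        (use that in \<open>auto intro!: derivative_eq_intros dU du simp: field_simps power2_eq_square power3_eq_cube\<close>)
    thus ?thesis by (rule DERIV_cong) (use that in \<open>simp add: field_simps\<close>)
  qed
  have isCont_f: "isCont f t" and isCont_g: "isCont g t" for t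
    using df clifford_deriv[of "\<beta> + 2" t] \<beta> unfolding g_def[symmetric]
    by (auto intro: DERIV_isCont)
  have contf: "continuous_on S f" and contg: "continuous_on S g" for S
    by (auto intro: continuous_at_imp_continuous_on isCont_f isCont_g)
  have contA: "continuous_on S A" for S
    unfolding A_def using \<beta> by (intro continuous_intros) auto
  have contW: "continuous_on {0..} W"
  proof -
    have U_eq: "U t = K * (t powr (\<beta> + 3/2) * A t)" for t
      by (simp add: U_def bessel_moment_def K_def A_def add_ac)
    \<comment> \<open>Only \<open>W\<close> at \<open>0\<close> is delicate: all three terms are \<open>t\<^bsup>2\<beta>+1\<^esup>\<close> times a continuous function.\<close>
    have "continuous_on {0..} (\<lambda>t. K\<^sup>2 * t powr (2 * \<beta> + 1) *
        (A t * ((\<beta> + 1/2) * f t - t\<^sup>2 * g t / 2) - (f t)\<^sup>2 / 2 + (t\<^sup>2 - \<kappa>) * (A t)\<^sup>2 / 2))"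
      using \<beta> by (intro continuous_intros contf contg contA continuous_on_powr') auto
    moreover have "K\<^sup>2 * t powr (2 * \<beta> + 1) *
        (A t * ((\<beta> + 1/2) * f t - t\<^sup>2 * g t / 2) - (f t)\<^sup>2 / 2 + (t\<^sup>2 - \<kappa>) * (A t)\<^sup>2 / 2) = W t"
      if "t \<in> {0..}" for t
    proof (cases "t = 0")
      case True
      thus ?thesis by (simp add: W_def U_def u_def)
    next
      case False
      hence t: "t > 0" using that by simp
      have "t powr (2 * \<beta> + 1) = t powr ((\<beta> - 1/2) + (\<beta> - 1/2) + 2)"
        by (simp add: algebra_simps)
      also have "\<dots> = t powr (\<beta> - 1/2) * t powr (\<beta> - 1/2) * t\<^sup>2"
        unfolding powr_add using t by (simp flip: powr_numeral)
      finally show ?thesis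
        unfolding W_def u_def v_def U_eq powr_shift[OF t] using t
        by (simp add: field_simps power2_eq_square)
    qed
    ultimately show ?thesis by (rule continuous_on_eq)
  qed
  obtain \<epsilon> where \<epsilon>: "\<epsilon> > 0" "\<And>t. 0 < t \<Longrightarrow> t < \<epsilon> \<Longrightarrow> U t > 0"
    using bessel_moment_pos_near_0[of \<beta> "1/2"] \<beta> unfolding U_def by auto
  have W_pos: "W t > 0" if "t > 0" for t
  proof (rule pos_if_deriv_nonneg[OF contW _ dW _ \<epsilon>(1) _ that])
    show "W 0 = 0" by (simp add: W_def U_def u_def)
    show "\<kappa> / t ^ 3 * (U t)\<^sup>2 \<ge> 0" if "t > 0" for t using \<kappa> that by simp
    show "\<kappa> / t ^ 3 * (U t)\<^sup>2 > 0" if "t > 0" "t < \<epsilon>" for t using \<kappa> that \<epsilon>(2)[of t] by simp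
  qed
  \<comment> \<open>At a zero of \<open>U\<close> only \<open>- u\<^sup>2 / 2\<close> survives in \<open>W\<close>.\<close>
  have U_nonzero: "U t \<noteq> 0" if "t > 0" for t
  proof
    assume "U t = 0"
    with W_pos[OF that] show False by (simp add: W_def not_less)
  qed
  show ?thesis
  proof (rule ccontr)
    assume "\<not> ?thesis"
    hence neg: "U x \<le> 0" by (simp add: U_def)
    define y where "y = min x (\<epsilon> / 2)"
    have y: "0 < y" "y \<le> x" "y < \<epsilon>" using x \<epsilon>(1) by (auto simp: y_def min_def)
    have "continuous_on {y..x} U"
      by (rule continuous_on_subset[OF continuous_on_bessel_moment[of \<beta> "1/2", folded U_def]])
        (use \<beta> y in auto)
    hence "\<exists>t\<ge>y. t \<le> x \<and> U t = 0"
      using neg \<epsilon>(2)[OF y(1,3)] y(2) by (intro IVT2') auto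
    thus False using U_nonzero y by force
  qed
qed

section \<open>Lowering the exponent\<close>

text \<open>
  The function \<open>H(x) = F\<^bsub>\<alpha>\<^esub>(x) - x\<^bsup>-d\<^esup> F\<^bsub>\<gamma>\<^esub>(x)\<close> with \<open>d = \<gamma> - \<alpha>\<close> is what remains of \<open>F\<^bsub>\<alpha>\<^esub>\<close> after
  subtracting the boundary term of an integration by parts in
  \<open>t\<^sup>\<alpha> J\<^sub>\<beta>(t) = t\<^bsup>-d\<^esup> (t\<^sup>\<gamma> J\<^sub>\<beta>(t))\<close>; its derivative is \<open>d x\<^bsup>-d-1\<^esup> F\<^bsub>\<gamma>\<^esub>(x)\<close>.
  The result is strictly positive even if \<open>F\<^bsub>\<gamma>\<^esub>\<close> has zeros, because \<open>F\<^bsub>\<gamma>\<^esub>\<close> is positive near the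
  origin. This is essential for \<open>\<beta> = \<gamma> = 1/2\<close>.
\<close>

lemma bessel_moment_pos_if_larger_exponent:
  assumes "\<beta> > -1" "\<alpha> + \<beta> > -1" and less: "\<alpha> < \<gamma>"
    and nonneg: "\<And>t. t > 0 \<Longrightarrow> bessel_moment \<gamma> \<beta> t \<ge> 0"
    and x: "x > 0"
  shows "bessel_moment \<alpha> \<beta> x > 0"
proof -
  define d where "d = \<gamma> - \<alpha>"
  have d: "d > 0" using less by (simp add: d_def)
  define H where "H = (\<lambda>t. bessel_moment \<alpha> \<beta> t - t powr - d * bessel_moment \<gamma> \<beta> t)"
  obtain \<epsilon> where \<epsilon>: "\<epsilon> > 0" "\<And>t. 0 < t \<Longrightarrow> t < \<epsilon> \<Longrightarrow> bessel_moment \<gamma> \<beta> t > 0"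
    using bessel_moment_pos_near_0[of \<beta> \<gamma>] assms by auto
  have "H x > 0"
  proof (rule pos_if_deriv_nonneg[OF _ _ _ _ \<epsilon>(1) _ x])
    let ?S = "moment_series (\<gamma> + \<beta> + 1) (\<beta> + 1)"
    have "continuous_on {0..} (\<lambda>t. bessel_moment \<alpha> \<beta> t - 2 powr - \<beta> * (t powr (\<alpha> + \<beta> + 1) * ?S (t\<^sup>2 / 4)))"
      using assms by (intro continuous_intros continuous_on_bessel_moment continuous_on_powr') auto
    moreover have "bessel_moment \<alpha> \<beta> t - 2 powr - \<beta> * (t powr (\<alpha> + \<beta> + 1) * ?S (t\<^sup>2 / 4)) = H t" for t
      by (simp add: H_def d_def bessel_moment_def mult.left_commute[of "t powr _" "2 powr _"]
          add.assoc flip: mult.assoc powr_add)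
    ultimately show "continuous_on {0..} H" by simp
    show "H 0 = 0" by (simp add: H_def)
    show "(H has_real_derivative d * t powr (- d - 1) * bessel_moment \<gamma> \<beta> t) (at t)" if "t > 0" for t
    proof -
      have "(H has_real_derivative t powr \<alpha> * bessel_J \<beta> t
          - ((- d * t powr (- d - 1)) * bessel_moment \<gamma> \<beta> t + (t powr \<gamma> * bessel_J \<beta> t) * t powr - d)) (at t)"
        unfolding H_def using assms that
        by (intro DERIV_diff DERIV_mult has_real_derivative_powr has_real_derivative_bessel_moment) auto
      moreover have "t powr \<gamma> * t powr - d = t powr \<alpha>"
        by (simp add: d_def flip: powr_add)
      ultimately show ?thesis by (elim DERIV_cong) (simp add: algebra_simps)
    qed
    show "d * t powr (- d - 1) * bessel_moment \<gamma> \<beta> t \<ge> 0" if "t > 0" for t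
      using d nonneg[OF that] by simp
    show "d * t powr (- d - 1) * bessel_moment \<gamma> \<beta> t > 0" if "t > 0" "t < \<epsilon>" for t
      using d that \<epsilon>(2)[of t] by simp
  qed
  moreover have "x powr - d * bessel_moment \<gamma> \<beta> x \<ge> 0" using nonneg[OF x] by simp
  ultimately show ?thesis by (simp add: H_def)
qed

section \<open>Positivity of the unweighted integral\<close>

lemma has_integral_bessel_moment:
  assumes "\<beta> > -1" "\<alpha> + \<beta> > -1" "x \<ge> 0"
  shows "((\<lambda>t. t powr \<alpha> * bessel_J \<beta> t) has_integral bessel_moment \<alpha> \<beta> x) {0..x}"
proof -
  have "((\<lambda>t. t powr \<alpha> * bessel_J \<beta> t) has_integral (bessel_moment \<alpha> \<beta> x - bessel_moment \<alpha> \<beta> 0)) {0..x}"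
    using assms
    by (intro fundamental_theorem_of_calculus_interior
        continuous_on_subset[OF continuous_on_bessel_moment])
      (auto simp flip: has_real_derivative_iff_has_vector_derivative
        intro!: has_real_derivative_bessel_moment)
  thus ?thesis by simp
qed

text \<open>
  By the duplication formula, \<open>k! \<Gamma>(k + 3/2)\<close> is a multiple of \<open>(2 k + 1)! / 4\<^sup>k\<close>, so the Bessel series
  becomes the sine series.
\<close>

lemma sqrt_mult_bessel_J_half:
  assumes t: "t > 0"
  shows "t powr (1/2) * bessel_J (1/2) t = sqrt 2 / sqrt pi * sin t"
proof -
  have coeff: "bessel_coeff (1/2 + 1) k * (t\<^sup>2 / 4) ^ k
      = 2 / (sqrt pi * t) * ((-1) ^ k / fact (2 * k + 1) * t ^ (2 * k + 1))" for k
  proof -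
    have "Gamma (real k + 1) = fact k" using Gamma_fact[of k, where 'a = real] by (simp add: add_ac)
    moreover have "Gamma (2 * (real k + 1)) = fact (2 * k + 1)"
      using Gamma_fact[of "2 * k + 1", where 'a = real] by (simp add: add_ac)
    moreover have "(2::real) powr (1 - 2 * (real k + 1)) = 1 / (2 * 4 ^ k)"
    proof -
      have "(4::real) ^ k = 2 powr (2 * real k)"
        by (simp add: powr_realpow flip: powr_powr)
      hence "(2::real) * 4 ^ k = 2 powr (2 * real k + 1)" by (simp add: powr_add)
      thus ?thesis by (simp add: algebra_simps flip: powr_minus_divide)
    qed
    moreover have "real k + (1/2 + 1) = real k + 1 + 1/2" by simp
    ultimately have "fact k * Gamma (real k + (1/2 + 1)) = sqrt pi * fact (2 * k + 1) / (2 * 4 ^ k)"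
      using Gamma_legendre_duplication_real[of "real k + 1"] by (simp only:) simp
    moreover have "(t\<^sup>2 / 4) ^ k = t ^ (2 * k) / 4 ^ k" by (simp add: power_divide power_mult)
    ultimately show ?thesis using t
      by (simp only: bessel_coeff_def) (simp add: field_simps)
  qed
  have "(\<lambda>k. bessel_coeff (1/2 + 1) k * (t\<^sup>2 / 4) ^ k) sums (2 / (sqrt pi * t) * sin t)"
    unfolding coeff by (intro sums_mult sin_paired)
  hence "bessel_clifford (1/2 + 1) (t\<^sup>2 / 4) = 2 / (sqrt pi * t) * sin t"
    unfolding bessel_clifford_def by (rule sums_unique[symmetric])
  hence "bessel_J (1/2) t = (t / 2) powr (1/2) * (2 / (sqrt pi * t) * sin t)"
    using t by (subst bessel_J_conv_clifford) auto
  hence "t powr (1/2) * bessel_J (1/2) t = sqrt t * (sqrt t / sqrt 2 * (2 / (sqrt pi * t) * sin t))"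
    using t by (simp only: powr_half_sqrt real_sqrt_divide less_imp_le divide_nonneg_nonneg zero_le_numeral)
  also have "\<dots> = (sqrt t * sqrt t) * (2 / sqrt 2) / (sqrt pi * t) * sin t"
    by (simp only: divide_inverse inverse_mult_distrib mult_ac)
  also have "\<dots> = \<bar>t\<bar> * sqrt 2 / (sqrt pi * t) * sin t"
    by (simp only: real_sqrt_mult_self real_div_sqrt zero_le_numeral)
  also have "\<dots> = sqrt 2 / sqrt pi * sin t" using t by simp
  finally show ?thesis .
qed

lemma bessel_moment_half_half:
  assumes "x \<ge> 0"
  shows "bessel_moment (1/2) (1/2) x = 2 * sqrt 2 / sqrt pi * (sin (x / 2))\<^sup>2"
proof -
  define C where "C = sqrt 2 / sqrt pi"
  have 1: "((\<lambda>t. C * sin t) has_integral (C * (1 - cos x) - C * (1 - cos 0))) {0..x}"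
    using assms
    by (intro fundamental_theorem_of_calculus_interior)
      (auto simp flip: has_real_derivative_iff_has_vector_derivative
        intro!: derivative_eq_intros continuous_intros)
  have 2: "((\<lambda>t. C * sin t) has_integral bessel_moment (1/2) (1/2) x) {0..x}"
  proof (rule has_integral_spike_finite[of "{0}"])
    show "((\<lambda>t. t powr (1/2) * bessel_J (1/2) t) has_integral bessel_moment (1/2) (1/2) x) {0..x}"
      using assms by (intro has_integral_bessel_moment) auto
  qed (auto simp: sqrt_mult_bessel_J_half C_def)
  have "bessel_moment (1/2) (1/2) x = C * (1 - cos x)"
    using has_integral_unique[OF 2 1] by simp
  also have "1 - cos x = 2 * (sin (x / 2))\<^sup>2"
    using cos_double_sin[of "x / 2"] by simp
  finally show ?thesis by (simp add: C_def)
qed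

lemma bessel_moment_half_half_nonneg: "x \<ge> 0 \<Longrightarrow> bessel_moment (1/2) (1/2) x \<ge> 0"
  by (simp only: bessel_moment_half_half) simp

lemma bessel_moment_pos:
  assumes "(\<beta>, \<alpha>) \<in> region_R" and ne: "\<not> (\<alpha> = 1/2 \<and> \<beta> = 1/2)" and x: "x > 0"
  shows "bessel_moment \<alpha> \<beta> x > 0"
proof (cases "\<alpha> \<le> 0")
  case True
  hence *: "\<beta> > -1" "\<alpha> + \<beta> > -1" using assms(1) by (auto simp: region_R_def)
  show ?thesis
  proof (cases "\<alpha> = 0")
    case True
    thus ?thesis using bessel_moment_exponent_0_pos[OF *(1) x] by simp
  next
    case False
    thus ?thesis
      using * x bessel_moment_exponent_0_pos[OF *(1)] \<open>\<alpha> \<le> 0\<close>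
      by (intro bessel_moment_pos_if_larger_exponent[of \<beta> \<alpha> 0]) (auto intro: less_imp_le)
  qed
next
  case False
  define \<gamma> where "\<gamma> = min \<beta> (1/2)"
  have *: "0 < \<alpha>" "\<alpha> \<le> \<gamma>" "\<beta> > 0" using assms(1) False by (auto simp: region_R_def \<gamma>_def)
  have base: "bessel_moment \<gamma> \<beta> t > 0" if "\<beta> \<noteq> 1/2" "t > 0" for t
    using bessel_moment_diagonal_pos[of \<beta> t] bessel_moment_half_pos[of \<beta> t] that *
    by (cases "\<beta> < 1/2") (auto simp: \<gamma>_def min_def)
  have base': "bessel_moment \<gamma> \<beta> t \<ge> 0" if "t > 0" for t
  proof (cases "\<beta> = 1/2")
    case True
    hence "\<gamma> = 1/2" by (simp add: \<gamma>_def)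
    thus ?thesis using bessel_moment_half_half_nonneg[of t] that True by (simp only: less_imp_le)
  qed (use base that in \<open>simp add: less_imp_le\<close>)
  show ?thesis
  proof (cases "\<alpha> = \<gamma>")
    case True
    with ne have "\<beta> \<noteq> 1/2" by (auto simp: \<gamma>_def)
    thus ?thesis using base x True by simp
  next
    case False
    thus ?thesis using * x base'
      by (intro bessel_moment_pos_if_larger_exponent[of \<beta> \<alpha> \<gamma>]) auto
  qed
qed

section \<open>Adding the weight\<close>

lemma continuous_on_bessel_J:
  assumes "\<beta> > -1"
  shows "continuous_on {0<..} (bessel_J \<beta>)"
proof -
  have "isCont (bessel_clifford (\<beta> + 1)) z" for z
    using has_real_derivative_bessel_clifford[of "\<beta> + 1" z] assms by (auto intro: DERIV_isCont)
  hence "continuous_on UNIV (bessel_clifford (\<beta> + 1))"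
    by (simp add: continuous_at_imp_continuous_on)
  hence "continuous_on {0<..} (\<lambda>t. bessel_clifford (\<beta> + 1) (t\<^sup>2 / 4))"
    by (rule continuous_on_compose2) (auto intro!: continuous_intros)
  moreover have "continuous_on {0<..} (\<lambda>t. (t / 2) powr \<beta>)"
    by (intro continuous_intros) auto
  ultimately have "continuous_on {0<..} (\<lambda>t. (t / 2) powr \<beta> * bessel_clifford (\<beta> + 1) (t\<^sup>2 / 4))"
    by (intro continuous_on_mult)
  thus ?thesis
    by (rule continuous_on_eq) (use assms in \<open>simp add: bessel_J_conv_clifford\<close>)
qed

text \<open>
  The weight and the entire factor of \<open>J\<^sub>\<beta>\<close> are bounded on \<open>(0, x)\<close>, so \<open>t\<^bsup>\<alpha>+\<beta>\<^esup>\<close> dominates.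
\<close>

lemma set_integrable_weighted_bessel:
  assumes "\<beta> > -1" "\<alpha> + \<beta> > -1" and \<mu>: "\<mu> > 0" and l: "l \<ge> 0"
  shows "set_integrable lborel {0<..<x}
           (\<lambda>t. (x powr \<mu> - t powr \<mu>) powr l * t powr \<alpha> * bessel_J \<beta> t)"
proof -
  let ?C = "bessel_clifford (\<beta> + 1)"
  have "isCont ?C z" for z
    using has_real_derivative_bessel_clifford[of "\<beta> + 1" z] assms by (auto intro: DERIV_isCont)
  hence "continuous_on {0..x\<^sup>2 / 4} ?C" by (simp add: continuous_at_imp_continuous_on)
  hence "bounded (?C ` {0..x\<^sup>2 / 4})"
    by (intro compact_imp_bounded compact_continuous_image) simp_all
  then obtain B where "\<forall>y \<in> ?C ` {0..x\<^sup>2 / 4}. \<bar>y\<bar> \<le> B"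
    unfolding bounded_iff real_norm_def by blast
  hence B: "\<bar>?C z\<bar> \<le> B" if "z \<in> {0..x\<^sup>2 / 4}" for z
    using that by blast
  define M where "M = (x powr \<mu>) powr l * (2 powr - \<beta> * B)"
  have less: "t powr \<mu> < x powr \<mu>" if "t \<in> {0<..<x}" for t
    using that \<mu> by (intro powr_less_mono2) auto
  show ?thesis
  proof (rule set_integrable_lborel_if_dominated)
    show "continuous_on {0<..<x} (\<lambda>t. (x powr \<mu> - t powr \<mu>) powr l * t powr \<alpha> * bessel_J \<beta> t)"
      using assms(1) less
      by (intro continuous_intros continuous_on_subset[OF continuous_on_bessel_J]) force+
    show "(\<lambda>t. M * t powr (\<alpha> + \<beta>)) integrable_on {0..x}"
      using assms by (cases "x \<ge> 0")
        (auto intro!: integrable_on_mult_right integrable_on_powr_from_0)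
    fix t assume t: "t \<in> {0<..<x}"
    have "t powr \<mu> \<le> x powr \<mu>" using t \<mu> by (intro powr_mono2) auto
    hence "(x powr \<mu> - t powr \<mu>) powr l \<le> (x powr \<mu>) powr l"
      using l by (intro powr_mono2) auto
    moreover have "\<bar>t powr \<alpha> * bessel_J \<beta> t\<bar> \<le> 2 powr - \<beta> * B * t powr (\<alpha> + \<beta>)"
    proof -
      have "t\<^sup>2 \<le> x\<^sup>2" using t by (intro power_mono) auto
      hence "\<bar>?C (t\<^sup>2 / 4)\<bar> \<le> B" by (intro B) auto
      hence "2 powr - \<beta> * t powr (\<alpha> + \<beta>) * \<bar>?C (t\<^sup>2 / 4)\<bar> \<le> 2 powr - \<beta> * t powr (\<alpha> + \<beta>) * B"
        by (intro mult_left_mono) auto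
      moreover have "\<bar>t powr \<alpha> * bessel_J \<beta> t\<bar> = 2 powr - \<beta> * t powr (\<alpha> + \<beta>) * \<bar>?C (t\<^sup>2 / 4)\<bar>"
        using t assms
        by (simp add: bessel_J_conv_clifford abs_mult powr_add powr_divide powr_minus field_simps)
      ultimately show ?thesis by (simp add: mult_ac)
    qed
    ultimately have "(x powr \<mu> - t powr \<mu>) powr l * \<bar>t powr \<alpha> * bessel_J \<beta> t\<bar>
        \<le> (x powr \<mu>) powr l * (2 powr - \<beta> * B * t powr (\<alpha> + \<beta>))"
      by (intro mult_mono) auto
    thus "\<bar>(x powr \<mu> - t powr \<mu>) powr l * t powr \<alpha> * bessel_J \<beta> t\<bar> \<le> M * t powr (\<alpha> + \<beta>)"
      by (simp add: M_def abs_mult mult_ac)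
  qed
qed

text \<open>
  The product of the weight and \<open>F\<close> vanishes at both end points: \<open>F\<close> at \<open>0\<close>, the weight at \<open>x\<close>.
  For \<open>l < 1\<close> the derivative of the weight is unbounded at \<open>x\<close>, but the Henstock-Kurzweil form
  of the fundamental theorem asks only for continuity there and yields integrability of \<open>h\<close>,
  the integrand after integration by parts.
\<close>

lemma weighted_bessel_integral_pos:
  assumes "\<beta> > -1" "\<alpha> + \<beta> > -1" and \<mu>: "\<mu> > 0" and l: "l > 0" and x: "x > 0"
    and nonneg: "\<And>t. t > 0 \<Longrightarrow> bessel_moment \<alpha> \<beta> t \<ge> 0"
  shows "(LBINT t:{0<..<x}. (x powr \<mu> - t powr \<mu>) powr l * t powr \<alpha> * bessel_J \<beta> t) > 0"
proof -
  define F where "F = bessel_moment \<alpha> \<beta>"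
  define f where "f = (\<lambda>t. (x powr \<mu> - t powr \<mu>) powr l * t powr \<alpha> * bessel_J \<beta> t)"
  define h where "h = (\<lambda>t. l * (x powr \<mu> - t powr \<mu>) powr (l - 1) * (\<mu> * t powr (\<mu> - 1)) * F t)"
  let ?I = "LBINT t:{0<..<x}. f t"
  have less: "t powr \<mu> < x powr \<mu>" if "t \<in> {0<..<x}" for t
    using that \<mu> by (intro powr_less_mono2) auto
  have int_f: "(f has_integral ?I) {0..x}"
    using set_borel_integral_eq_integral[OF set_integrable_weighted_bessel[OF assms(1-3), of l x]] l
    unfolding has_integral_Icc_iff_Ioo by (simp add: f_def has_integral_iff)
  have "((\<lambda>t. f t - h t) has_integral
      (x powr \<mu> - x powr \<mu>) powr l * F x - (x powr \<mu> - 0 powr \<mu>) powr l * F 0) {0..x}"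
  proof (rule fundamental_theorem_of_calculus_interior)
    show "continuous_on {0..x} (\<lambda>t. (x powr \<mu> - t powr \<mu>) powr l * F t)"
      unfolding F_def using \<mu> l assms(1,2)
      by (intro continuous_intros continuous_on_powr' continuous_on_subset[OF continuous_on_bessel_moment])
        (auto intro: powr_mono2)
    fix t assume t: "t \<in> {0<..<x}"
    have "((\<lambda>t. (x powr \<mu> - t powr \<mu>) powr l) has_real_derivative
        (l * (x powr \<mu> - t powr \<mu>) powr (l - 1)) * (0 - \<mu> * t powr (\<mu> - 1))) (at t)"
      using t less[OF t]
      by (intro DERIV_chain2[where g = "\<lambda>t. x powr \<mu> - t powr \<mu>" and f = "\<lambda>y. y powr l"]
          DERIV_diff DERIV_const has_real_derivative_powr) auto
    moreover have "(F has_real_derivative t powr \<alpha> * bessel_J \<beta> t) (at t)"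
      unfolding F_def using t assms by (intro has_real_derivative_bessel_moment) auto
    ultimately have "((\<lambda>t. (x powr \<mu> - t powr \<mu>) powr l * F t) has_real_derivative
        (l * (x powr \<mu> - t powr \<mu>) powr (l - 1)) * (0 - \<mu> * t powr (\<mu> - 1)) * F t
          + (t powr \<alpha> * bessel_J \<beta> t) * (x powr \<mu> - t powr \<mu>) powr l) (at t)"
      by (rule DERIV_mult)
    hence "((\<lambda>t. (x powr \<mu> - t powr \<mu>) powr l * F t) has_real_derivative f t - h t) (at t)"
      by (rule DERIV_cong) (simp add: f_def h_def algebra_simps)
    thus "((\<lambda>t. (x powr \<mu> - t powr \<mu>) powr l * F t) has_vector_derivative f t - h t) (at t)"
      by (simp add: has_real_derivative_iff_has_vector_derivative)
  qed (use x in auto)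
  hence "((\<lambda>t. f t - h t) has_integral 0) {0..x}" using l by (simp add: F_def)
  from has_integral_diff[OF int_f this] have int_h: "(h has_integral ?I) {0..x}" by simp
  obtain \<epsilon> where \<epsilon>: "\<epsilon> > 0" "\<And>t. 0 < t \<Longrightarrow> t < \<epsilon> \<Longrightarrow> F t > 0"
    using bessel_moment_pos_near_0[OF assms(1,2)] unfolding F_def by auto
  define c where "c = min x \<epsilon> / 2"
  have c: "c \<in> {0<..<x}" "c < \<epsilon>" using x \<epsilon>(1) by (auto simp: c_def min_def)
  have "?I > 0"
  proof (rule integral_pos_if_continuous_nonneg[OF int_h _ _ c(1)])
    show "continuous_on {0<..<x} h"
      unfolding h_def F_def using assms(1,2) less
      by (intro continuous_intros continuous_on_subset[OF continuous_on_bessel_moment]) force+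
    show "h t \<ge> 0" if "t \<in> {0<..<x}" for t
      using that l \<mu> nonneg[of t] by (simp add: h_def F_def)
    show "h c > 0"
      using c l \<mu> \<epsilon>(2)[of c] less[OF c(1)] by (simp add: h_def)
  qed
  thus ?thesis by (simp add: f_def)
qed

theorem theorem2p1:
  fixes \<mu> l \<beta> \<alpha> :: real
  assumes "\<mu> > 0" and "l \<ge> 0" and "(\<beta>, \<alpha>) \<in> region_R"
  shows "(\<not> (l = 0 \<and> \<alpha> = 1 / 2 \<and> \<beta> = 1 / 2) \<longrightarrow>
           (\<forall>x>0. set_integrable lborel {0<..<x}
                    (\<lambda>t. (x powr \<mu> - t powr \<mu>) powr l * t powr \<alpha> * bessel_J \<beta> t) \<and>
                  (LBINT t:{0<..<x}. (x powr \<mu> - t powr \<mu>) powr l * t powr \<alpha> * bessel_J \<beta> t) > 0))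
       \<and> (l = 0 \<and> \<alpha> = 1 / 2 \<and> \<beta> = 1 / 2 \<longrightarrow>
           (\<forall>x>0. set_integrable lborel {0<..<x} (\<lambda>t. bessel_J (1 / 2) t * sqrt t) \<and>
                  (LBINT t:{0<..<x}. bessel_J (1 / 2) t * sqrt t)
                    = 2 * sqrt 2 / sqrt pi * (sin (x / 2))\<^sup>2 \<and>
                  2 * sqrt 2 / sqrt pi * (sin (x / 2))\<^sup>2 \<ge> 0))"
proof -
  have \<beta>: "\<beta> > -1" "\<alpha> + \<beta> > -1" using assms(3) by (auto simp: region_R_def)
  \<comment> \<open>\<open>y powr 0\<close> is \<open>1\<close> only for \<open>y \<noteq> 0\<close>, hence the open interval.\<close>
  have weight0: "(x powr \<mu> - t powr \<mu>) powr 0 = 1" if "t \<in> {0<..<x}" for t x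
    using powr_less_mono2[of \<mu> t x] that \<open>\<mu> > 0\<close> by auto
  have nonneg: "bessel_moment \<alpha> \<beta> t \<ge> 0" if "t > 0" for t
    using bessel_moment_pos[OF assms(3) _ that] bessel_moment_half_half_nonneg[of t] that
    by (cases "\<alpha> = 1/2 \<and> \<beta> = 1/2") (blast intro: less_imp_le, fastforce intro: less_imp_le)
  note integrable = set_integrable_weighted_bessel[OF \<beta> \<open>\<mu> > 0\<close> \<open>l \<ge> 0\<close>]
  have unweighted: "(LBINT t:{0<..<x}. (x powr \<mu> - t powr \<mu>) powr l * t powr \<alpha> * bessel_J \<beta> t)
      = bessel_moment \<alpha> \<beta> x" if "l = 0" "x > 0" for x
  proof -
    have "(LBINT t:{0<..<x}. (x powr \<mu> - t powr \<mu>) powr l * t powr \<alpha> * bessel_J \<beta> t)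
        = integral {0<..<x} (\<lambda>t. (x powr \<mu> - t powr \<mu>) powr l * t powr \<alpha> * bessel_J \<beta> t)"
      by (rule set_borel_integral_eq_integral(2)[OF integrable])
    also have "\<dots> = integral {0<..<x} (\<lambda>t. t powr \<alpha> * bessel_J \<beta> t)"
      by (rule integral_cong) (simp only: \<open>l = 0\<close> weight0 mult_1)
    also have "\<dots> = bessel_moment \<alpha> \<beta> x"
      using has_integral_bessel_moment[OF \<beta>, of x] \<open>x > 0\<close>
      by (simp add: has_integral_Icc_iff_Ioo integral_unique)
    finally show ?thesis .
  qed
  show ?thesis
  proof (intro conjI impI allI)
    fix x :: real assume x: "x > 0" and ne: "\<not> (l = 0 \<and> \<alpha> = 1 / 2 \<and> \<beta> = 1 / 2)"
    show "set_integrable lborel {0<..<x} (\<lambda>t. (x powr \<mu> - t powr \<mu>) powr l * t powr \<alpha> * bessel_J \<beta> t)"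
      by (rule integrable)
    show "(LBINT t:{0<..<x}. (x powr \<mu> - t powr \<mu>) powr l * t powr \<alpha> * bessel_J \<beta> t) > 0"
    proof (cases "l = 0")
      case True
      thus ?thesis using unweighted[OF True x] bessel_moment_pos[OF assms(3) _ x] ne by simp
    next
      case False
      thus ?thesis
        using \<beta> \<open>\<mu> > 0\<close> \<open>l \<ge> 0\<close> x nonneg by (intro weighted_bessel_integral_pos) auto
    qed
  next
    fix x :: real assume x: "x > 0" and eq: "l = 0 \<and> \<alpha> = 1 / 2 \<and> \<beta> = 1 / 2"
    have integrand: "(x powr \<mu> - t powr \<mu>) powr l * t powr \<alpha> * bessel_J \<beta> t = bessel_J (1 / 2) t * sqrt t"
      if "t \<in> {0<..<x}" for t
    proof -
      have "(x powr \<mu> - t powr \<mu>) powr l = 1" using eq weight0[OF that] by (simp only:)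
      moreover have "t powr \<alpha> = sqrt t" using eq that by (simp only: powr_half_sqrt) (simp add: powr_half_sqrt)
      moreover have "\<beta> = 1 / 2" using eq by blast
      ultimately show ?thesis by (simp only: mult_1 mult.commute)
    qed
    show "set_integrable lborel {0<..<x} (\<lambda>t. bessel_J (1 / 2) t * sqrt t)"
      by (rule set_integrable_cong[THEN iffD1, OF refl refl _ integrable[of x]]) (rule integrand)
    have "(LBINT t:{0<..<x}. bessel_J (1 / 2) t * sqrt t)
        = (LBINT t:{0<..<x}. (x powr \<mu> - t powr \<mu>) powr l * t powr \<alpha> * bessel_J \<beta> t)"
      by (rule set_lebesgue_integral_cong) (auto simp: integrand)
    also have "\<dots> = 2 * sqrt 2 / sqrt pi * (sin (x / 2))\<^sup>2"
      using unweighted[OF _ x] eq bessel_moment_half_half[OF less_imp_le[OF x]] by metis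
    finally show "(LBINT t:{0<..<x}. bessel_J (1 / 2) t * sqrt t) = 2 * sqrt 2 / sqrt pi * (sin (x / 2))\<^sup>2" .
  qed simp
qed

end
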